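(* Let $G$ be a group and $H$ a subgroup of $G$. Then the full subcategory $G\text{-}\mathbf{Set}_H$ of $H$-generated $G$-sets is coreflective in $G\text{-}\mathbf{Set}$ (that is, the inclusion functor has a right adjoint), and the coreflector is the $H$-trace functor $\operatorname{Tr}_H$.
   Context: $G\text{-}\mathbf{Set}$ is the category of (left) $G$-sets and $G$-equivariant maps; $G/H$ is the set of left cosets of $H$ with the left translation action. A $G$-set $X$ is $H$-generated if there exist a set $I$ and a surjective $G$-equivariant map $\coprod_{i\in I} G/H\to X$. For a $G$-set $X$, the $H$-trace is $\operatorname{Tr}_H(X)=\bigcup\{\operatorname{im}(\alpha)\mid \alpha\colon G/H\to X \text{ a } G\text{-equivariant map}\}$, a $G$-subset of $X$; on a $G$-equivariant map $\beta\colon X\to Y$, $\operatorname{Tr}_H(\beta)\colon\operatorname{Tr}_H(X)\to\operatorname{Tr}_H(Y)$ is the restriction of $\beta$. The coreflection morphism at $Y$ is the inclusion $\operatorname{Tr}_H(Y)\hookrightarrow Y$. *)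

theory Defs
  imports "HOL-Algebra.Group_Action" "HOL-Algebra.Left_Coset" "HOL-Library.FuncSet"
begin

section \<open>Categories, functors and adjunctions\<close>

text \<open>
  Hom-sets are indexed by source and target and need not be disjoint, so composition and the
  arrow part of a functor take the objects as arguments: \<open>Comp C X Y Z g f\<close> is the composite of
  \<open>f : X \<rightarrow> Y\<close> and \<open>g : Y \<rightarrow> Z\<close>.
\<close>

record ('o, 'm) cat =
  Ob :: "'o set"
  Hom :: "'o \<Rightarrow> 'o \<Rightarrow> 'm set"
  Ident :: "'o \<Rightarrow> 'm"
  Comp :: "'o \<Rightarrow> 'o \<Rightarrow> 'o \<Rightarrow> 'm \<Rightarrow> 'm \<Rightarrow> 'm"

locale category =
  fixes C :: "('o, 'm) cat"
  assumes ident_in: "X \<in> Ob C \<Longrightarrow> Ident C X \<in> Hom C X X"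
    and comp_in: "\<lbrakk>X \<in> Ob C; Y \<in> Ob C; Z \<in> Ob C; f \<in> Hom C X Y; g \<in> Hom C Y Z\<rbrakk>
      \<Longrightarrow> Comp C X Y Z g f \<in> Hom C X Z"
    and ident_left: "\<lbrakk>X \<in> Ob C; Y \<in> Ob C; f \<in> Hom C X Y\<rbrakk>
      \<Longrightarrow> Comp C X Y Y (Ident C Y) f = f"
    and ident_right: "\<lbrakk>X \<in> Ob C; Y \<in> Ob C; f \<in> Hom C X Y\<rbrakk>
      \<Longrightarrow> Comp C X X Y f (Ident C X) = f"
    and comp_assoc: "\<lbrakk>W \<in> Ob C; X \<in> Ob C; Y \<in> Ob C; Z \<in> Ob C;
        f \<in> Hom C W X; g \<in> Hom C X Y; h \<in> Hom C Y Z\<rbrakk>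
      \<Longrightarrow> Comp C W X Z (Comp C X Y Z h g) f = Comp C W Y Z h (Comp C W X Y g f)"

record ('o, 'm, 'p, 'n) cfunctor =
  obj_map :: "'o \<Rightarrow> 'p"
  arr_map :: "'o \<Rightarrow> 'o \<Rightarrow> 'm \<Rightarrow> 'n"

locale is_functor = source: category C + target: category D
  for C :: "('o, 'm) cat" and D :: "('p, 'n) cat" and F :: "('o, 'm, 'p, 'n) cfunctor" +
  assumes obj_map_in: "X \<in> Ob C \<Longrightarrow> obj_map F X \<in> Ob D"
    and arr_map_in: "\<lbrakk>X \<in> Ob C; Y \<in> Ob C; f \<in> Hom C X Y\<rbrakk>
      \<Longrightarrow> arr_map F X Y f \<in> Hom D (obj_map F X) (obj_map F Y)"
    and arr_map_ident: "X \<in> Ob C \<Longrightarrow> arr_map F X X (Ident C X) = Ident D (obj_map F X)"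
    and arr_map_comp: "\<lbrakk>X \<in> Ob C; Y \<in> Ob C; Z \<in> Ob C; f \<in> Hom C X Y; g \<in> Hom C Y Z\<rbrakk>
      \<Longrightarrow> arr_map F X Z (Comp C X Y Z g f)
        = Comp D (obj_map F X) (obj_map F Y) (obj_map F Z) (arr_map F Y Z g) (arr_map F X Y f)"

text \<open>Used both for identity functors and for inclusions of subcategories.\<close>

definition incl_functor :: "('o, 'm, 'o, 'm) cfunctor" where
  "incl_functor = \<lparr>obj_map = (\<lambda>X. X), arr_map = (\<lambda>X Y f. f)\<rparr>"

definition comp_functor ::
  "('p, 'n, 'q, 'l) cfunctor \<Rightarrow> ('o, 'm, 'p, 'n) cfunctor \<Rightarrow> ('o, 'm, 'q, 'l) cfunctor" where
  "comp_functor K F =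
    \<lparr>obj_map = (\<lambda>X. obj_map K (obj_map F X)),
     arr_map = (\<lambda>X Y f. arr_map K (obj_map F X) (obj_map F Y) (arr_map F X Y f))\<rparr>"

locale nat_trans = dom: is_functor C D F + cod: is_functor C D K
  for C :: "('o, 'm) cat" and D :: "('p, 'n) cat" and F K :: "('o, 'm, 'p, 'n) cfunctor"
    and \<tau> :: "'o \<Rightarrow> 'n" +
  assumes component_in: "X \<in> Ob C \<Longrightarrow> \<tau> X \<in> Hom D (obj_map F X) (obj_map K X)"
    and naturality: "\<lbrakk>X \<in> Ob C; Y \<in> Ob C; f \<in> Hom C X Y\<rbrakk>
      \<Longrightarrow> Comp D (obj_map F X) (obj_map F Y) (obj_map K Y) (\<tau> Y) (arr_map F X Y f)
        = Comp D (obj_map F X) (obj_map K X) (obj_map K Y) (arr_map K X Y f) (\<tau> X)"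

text \<open>\<open>F : C \<rightarrow> D\<close> is left adjoint to \<open>R : D \<rightarrow> C\<close>, with unit \<open>\<eta>\<close> and counit \<open>\<epsilon>\<close>.\<close>

locale adjunction =
  left: is_functor C D F + right: is_functor D C R +
  unit: nat_trans C C incl_functor "comp_functor R F" \<eta> +
  counit: nat_trans D D "comp_functor F R" incl_functor \<epsilon>
  for C :: "('o, 'm) cat" and D :: "('p, 'n) cat"
    and F :: "('o, 'm, 'p, 'n) cfunctor" and R :: "('p, 'n, 'o, 'm) cfunctor"
    and \<eta> :: "'o \<Rightarrow> 'm" and \<epsilon> :: "'p \<Rightarrow> 'n" +
  assumes triangle_left: "X \<in> Ob C \<Longrightarrow>
      Comp D (obj_map F X) (obj_map F (obj_map R (obj_map F X))) (obj_map F X)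
        (\<epsilon> (obj_map F X)) (arr_map F X (obj_map R (obj_map F X)) (\<eta> X))
      = Ident D (obj_map F X)"
    and triangle_right: "Y \<in> Ob D \<Longrightarrow>
      Comp C (obj_map R Y) (obj_map R (obj_map F (obj_map R Y))) (obj_map R Y)
        (arr_map R (obj_map F (obj_map R Y)) Y (\<epsilon> Y)) (\<eta> (obj_map R Y))
      = Ident C (obj_map R Y)"

definition full_subcat :: "('o, 'm) cat \<Rightarrow> 'o set \<Rightarrow> ('o, 'm) cat" where
  "full_subcat C S = C\<lparr>Ob := S\<rparr>"

text \<open>
  \<open>R\<close> is a right adjoint of the inclusion of the full subcategory on \<open>S\<close> into \<open>C\<close>, with
  coreflection morphisms (counit) \<open>\<epsilon>\<close>.
\<close>

definition is_coreflector ::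
  "('o, 'm) cat \<Rightarrow> 'o set \<Rightarrow> ('o, 'm, 'o, 'm) cfunctor \<Rightarrow> ('o \<Rightarrow> 'm) \<Rightarrow> bool" where
  "is_coreflector C S R \<epsilon> \<longleftrightarrow>
    S \<subseteq> Ob C \<and> (\<exists>\<eta>. adjunction (full_subcat C S) C incl_functor R \<eta> \<epsilon>)"

definition coreflective :: "('o, 'm) cat \<Rightarrow> 'o set \<Rightarrow> bool" where
  "coreflective C S \<longleftrightarrow> (\<exists>R \<epsilon>. is_coreflector C S R \<epsilon>)"


section \<open>G-sets\<close>

record ('g, 'x) gset =
  pts :: "'x set"
  act :: "'g \<Rightarrow> 'x \<Rightarrow> 'x"

text \<open>
  Each \<open>act X g\<close> with \<open>g \<in> carrier G\<close> is already extensional on \<open>pts X\<close> by \<open>group_action\<close>.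
  Requiring \<open>act X\<close> to be extensional on \<open>carrier G\<close> as well makes the records satisfying
  \<open>is_gset G\<close> correspond one-to-one to the G-sets with points in \<open>'x\<close>.
\<close>

definition is_gset :: "('g, 'b) monoid_scheme \<Rightarrow> ('g, 'x) gset \<Rightarrow> bool" where
  "is_gset G X \<longleftrightarrow> group_action G (pts X) (act X) \<and> act X \<in> extensional (carrier G)"

definition equivariant_maps ::
  "('g, 'b) monoid_scheme \<Rightarrow> ('g, 'x) gset \<Rightarrow> ('g, 'y) gset \<Rightarrow> ('x \<Rightarrow> 'y) set" where
  "equivariant_maps G X Y =
    {f \<in> pts X \<rightarrow>\<^sub>E pts Y. \<forall>g \<in> carrier G. \<forall>x \<in> pts X. f (act X g x) = act Y g (f x)}"

definition GSet :: "('g, 'b) monoid_scheme \<Rightarrow> (('g, 'x) gset, 'x \<Rightarrow> 'x) cat" where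
  "GSet G =
    \<lparr>Ob = {X. is_gset G X},
     Hom = equivariant_maps G,
     Ident = (\<lambda>X. \<lambda>x \<in> pts X. x),
     Comp = (\<lambda>X Y Z g f. compose (pts X) g f)\<rparr>"

definition coset_gset :: "('g, 'b) monoid_scheme \<Rightarrow> 'g set \<Rightarrow> ('g, 'g set) gset" where
  "coset_gset G H =
    \<lparr>pts = lcosets\<^bsub>G\<^esub> H, act = (\<lambda>g \<in> carrier G. \<lambda>K \<in> lcosets\<^bsub>G\<^esub> H. g <#\<^bsub>G\<^esub> K)\<rparr>"

definition coprod_gset ::
  "('g, 'b) monoid_scheme \<Rightarrow> 'i set \<Rightarrow> ('i \<Rightarrow> ('g, 'x) gset) \<Rightarrow> ('g, 'i \<times> 'x) gset" where
  "coprod_gset G I X =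
    \<lparr>pts = (SIGMA i:I. pts (X i)),
     act = (\<lambda>g \<in> carrier G. \<lambda>(i, x) \<in> (SIGMA i:I. pts (X i)). (i, act (X i) g x))\<rparr>"

text \<open>
  HOL cannot quantify existentially over the type of the index set \<open>I\<close>; index sets inside the
  type of points suffice, by the lemma \<open>H_generatedI\<close> below.
\<close>

definition H_generated ::
  "('g, 'b) monoid_scheme \<Rightarrow> 'g set \<Rightarrow> ('g, 'x) gset \<Rightarrow> bool" where
  "H_generated G H X \<longleftrightarrow>
    (\<exists>(I :: 'x set) p. p \<in> equivariant_maps G (coprod_gset G I (\<lambda>_. coset_gset G H)) X \<and>
      p ` pts (coprod_gset G I (\<lambda>_. coset_gset G H)) = pts X)"

definition GSet_H_objs ::
  "('g, 'b) monoid_scheme \<Rightarrow> 'g set \<Rightarrow> ('g, 'x) gset set" where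
  "GSet_H_objs G H = {X. is_gset G X \<and> H_generated G H X}"

definition trace_pts :: "('g, 'b) monoid_scheme \<Rightarrow> 'g set \<Rightarrow> ('g, 'x) gset \<Rightarrow> 'x set" where
  "trace_pts G H X = (\<Union>\<alpha> \<in> equivariant_maps G (coset_gset G H) X. \<alpha> ` pts (coset_gset G H))"

definition trace_gset ::
  "('g, 'b) monoid_scheme \<Rightarrow> 'g set \<Rightarrow> ('g, 'x) gset \<Rightarrow> ('g, 'x) gset" where
  "trace_gset G H X =
    \<lparr>pts = trace_pts G H X,
     act = (\<lambda>g \<in> carrier G. restrict (act X g) (trace_pts G H X))\<rparr>"

definition trace_functor ::
  "('g, 'b) monoid_scheme \<Rightarrow> 'g set \<Rightarrow>
    (('g, 'x) gset, 'x \<Rightarrow> 'x, ('g, 'x) gset, 'x \<Rightarrow> 'x) cfunctor" where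
  "trace_functor G H =
    \<lparr>obj_map = trace_gset G H,
     arr_map = (\<lambda>X Y \<beta>. restrict \<beta> (pts (trace_gset G H X)))\<rparr>"

definition trace_inclusion ::
  "('g, 'b) monoid_scheme \<Rightarrow> 'g set \<Rightarrow> ('g, 'x) gset \<Rightarrow> 'x \<Rightarrow> 'x" where
  "trace_inclusion G H Y = (\<lambda>y \<in> pts (trace_gset G H Y). y)"

lemma lcosets_closed:
  assumes "group G" "subgroup H G" "g \<in> carrier G" "K \<in> lcosets\<^bsub>G\<^esub> H"
  shows "g <#\<^bsub>G\<^esub> K \<in> lcosets\<^bsub>G\<^esub> H"
proof -
  interpret group G by fact
  obtain a where a: "a \<in> carrier G" "K = a <#\<^bsub>G\<^esub> H"
    using assms(4) by (auto simp: LCOSETS_def)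
  have "g <#\<^bsub>G\<^esub> K = (g \<otimes>\<^bsub>G\<^esub> a) <#\<^bsub>G\<^esub> H"
    using a assms(2,3) lcos_m_assoc subgroup.subset by blast
  then show ?thesis
    using a assms(3) by (auto simp: LCOSETS_def)
qed

lemma subgroup_in_lcosets:
  assumes "group G" "subgroup H G"
  shows "H \<in> lcosets\<^bsub>G\<^esub> H"
proof -
  interpret group G by fact
  have "\<one>\<^bsub>G\<^esub> <#\<^bsub>G\<^esub> H = H"
    using assms(2) by (simp add: lcos_mult_one subgroup.subset)
  then show ?thesis
    unfolding LCOSETS_def by blast
qed

lemma H_generatedI:
  fixes X :: "('g, 'x) gset" and I :: "'i set"
  assumes "group G" "subgroup H G"
    and p: "p \<in> equivariant_maps G (coprod_gset G I (\<lambda>_. coset_gset G H)) X"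
    and surj: "p ` pts (coprod_gset G I (\<lambda>_. coset_gset G H)) = pts X"
  shows "H_generated G H X"
proof -
  interpret group G by fact
  define J where "J = (\<lambda>i. p (i, H)) ` I"
  define s where "s = inv_into I (\<lambda>i. p (i, H))"
  have s: "s j \<in> I" "p (s j, H) = j" if "j \<in> J" for j
    using that unfolding J_def s_def
    by (auto intro: inv_into_into f_inv_into_f[where f = "\<lambda>i. p (i, H)"])
  define L where "L = lcosets\<^bsub>G\<^esub> H"
  have L: "g <#\<^bsub>G\<^esub> K \<in> L" if "g \<in> carrier G" "K \<in> L" for g K
    using lcosets_closed[OF assms(1,2)] that unfolding L_def by simp
  have HL: "H \<in> L" unfolding L_def by (rule subgroup_in_lcosets[OF assms(1,2)])
  have pE: "p (i, K) \<in> pts X" if "i \<in> I" "K \<in> L" for i K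
    using p that by (auto simp: equivariant_maps_def coprod_gset_def coset_gset_def L_def)
  have peq: "p (i, g <#\<^bsub>G\<^esub> K) = act X g (p (i, K))" if "i \<in> I" "K \<in> L" "g \<in> carrier G" for i K g
  proof -
    have "p (act (coprod_gset G I (\<lambda>_. coset_gset G H)) g (i, K)) = act X g (p (i, K))"
      using p that by (auto simp: equivariant_maps_def coprod_gset_def coset_gset_def L_def)
    then show ?thesis using that by (simp add: coprod_gset_def coset_gset_def L_def)
  qed
  have factor: "p (i, K) = p (s (p (i, H)), K)" if "i \<in> I" "K \<in> L" for i K
  proof -
    obtain a where a: "a \<in> carrier G" and K: "K = a <#\<^bsub>G\<^esub> H"
      using \<open>K \<in> L\<close> by (auto simp: L_def LCOSETS_def)
    have J: "p (i, H) \<in> J" using that unfolding J_def by blast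
    have "p (i, K) = act X a (p (i, H))"
      unfolding K by (rule peq[OF that(1) HL a])
    also have "\<dots> = act X a (p (s (p (i, H)), H))"
      by (simp only: s(2)[OF J])
    also have "\<dots> = p (s (p (i, H)), K)"
      unfolding K by (rule peq[OF s(1)[OF J] HL a, symmetric])
    finally show ?thesis .
  qed
  define q where "q = (\<lambda>(j, K) \<in> J \<times> L. p (s j, K))"
  have "q \<in> equivariant_maps G (coprod_gset G J (\<lambda>_. coset_gset G H)) X"
    unfolding equivariant_maps_def coprod_gset_def coset_gset_def q_def L_def[symmetric]
    using s(1) pE peq L by auto
  moreover have "q ` pts (coprod_gset G J (\<lambda>_. coset_gset G H)) = pts X"
  proof -
    have "q ` (J \<times> L) = p ` (I \<times> L)"
    proof
      show "q ` (J \<times> L) \<subseteq> p ` (I \<times> L)"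
        using s by (auto simp: q_def)
      show "p ` (I \<times> L) \<subseteq> q ` (J \<times> L)"
      proof clarify
        fix i K assume iK: "i \<in> I" "K \<in> L"
        then have "p (i, H) \<in> J" unfolding J_def by blast
        then have "q (p (i, H), K) = p (i, K)"
          using factor[OF iK] iK by (simp add: q_def)
        then show "p (i, K) \<in> q ` (J \<times> L)"
          using \<open>p (i, H) \<in> J\<close> iK by (metis SigmaI imageI)
      qed
    qed
    then show ?thesis
      using surj by (simp add: coprod_gset_def coset_gset_def flip: L_def)
  qed
  ultimately show ?thesis unfolding H_generated_def by blast
qed

end

(*
  An H-generated G-set equals its own H-trace: restricting a surjection from a coproduct of copies
  of G/H to the summands exhibits every point in the image of an equivariant map G/H -> X.
  Conversely, the trace of any X is H-generated, by the coproduct indexed by all equivariant maps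
  G/H -> X. As equivariant maps carry traces into traces, Tr_H is right adjoint to the inclusion;
  the unit is the identity and the counit is the inclusion of the trace.
*)
theory Submission
  imports Defs
begin

section \<open>Full subcategories and functors\<close>

lemma full_subcat_simps [simp]:
  "Ob (full_subcat C S) = S"
  "Hom (full_subcat C S) = Hom C"
  "Ident (full_subcat C S) = Ident C"
  "Comp (full_subcat C S) = Comp C"
  by (simp_all add: full_subcat_def)

lemma incl_functor_simps [simp]:
  "obj_map incl_functor X = X"
  "arr_map incl_functor X Y f = f"
  by (simp_all add: incl_functor_def)

lemma comp_functor_simps [simp]:
  "obj_map (comp_functor K F) X = obj_map K (obj_map F X)"
  "arr_map (comp_functor K F) X Y f = arr_map K (obj_map F X) (obj_map F Y) (arr_map F X Y f)"
  by (simp_all add: comp_functor_def)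

lemma category_full_subcat:
  assumes "category C" "S \<subseteq> Ob C"
  shows "category (full_subcat C S)"
proof -
  interpret category C by fact
  have S: "X \<in> Ob C" if "X \<in> S" for X
    using that assms(2) by blast
  show ?thesis
    by unfold_locales (simp_all add: S ident_in comp_in ident_left ident_right comp_assoc)
qed

text \<open>Here \<open>incl_functor\<close> serves as an identity functor: it is the source of the
  unit and the target of the counit in \<open>adjunction\<close>.\<close>

lemma is_functor_incl_self:
  assumes "category C"
  shows "is_functor C C incl_functor"
  using assms by (simp add: is_functor_def is_functor_axioms_def)

lemma is_functor_incl:
  assumes "category C" "S \<subseteq> Ob C"
  shows "is_functor (full_subcat C S) C incl_functor"
  using assms category_full_subcat[OF assms]
  by (auto simp: is_functor_def is_functor_axioms_def)

lemma is_functor_comp: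
  assumes "is_functor C D F" "is_functor D E K"
  shows "is_functor C E (comp_functor K F)"
proof -
  interpret F: is_functor C D F by fact
  interpret K: is_functor D E K by fact
  show ?thesis
    by unfold_locales
      (simp_all add: F.obj_map_in F.arr_map_in F.arr_map_ident F.arr_map_comp
        K.obj_map_in K.arr_map_in K.arr_map_ident K.arr_map_comp)
qed

section \<open>G-sets and equivariant maps\<close>

text \<open>Replaces the homomorphism into \<open>BijGroup\<close> by pointwise axioms. Bijectivity
  of each \<open>act X g\<close> comes for free, because the inverse element of the group acts as
  the inverse map.\<close>

lemma is_gsetI:
  assumes "group G"
    and ext: "act X \<in> extensional (carrier G)"
    and ext': "\<And>g. g \<in> carrier G \<Longrightarrow> act X g \<in> extensional (pts X)"
    and closed: "\<And>g x. \<lbrakk>g \<in> carrier G; x \<in> pts X\<rbrakk> \<Longrightarrow> act X g x \<in> pts X"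
    and one: "\<And>x. x \<in> pts X \<Longrightarrow> act X \<one>\<^bsub>G\<^esub> x = x"
    and mult: "\<And>g h x. \<lbrakk>g \<in> carrier G; h \<in> carrier G; x \<in> pts X\<rbrakk>
      \<Longrightarrow> act X (g \<otimes>\<^bsub>G\<^esub> h) x = act X g (act X h x)"
  shows "is_gset G X"
proof -
  interpret group G by fact
  have inverse: "act X g (act X (inv\<^bsub>G\<^esub> g) x) = x" "act X (inv\<^bsub>G\<^esub> g) (act X g x) = x"
    if "g \<in> carrier G" "x \<in> pts X" for g x
    using that by (simp_all add: one flip: mult)
  have Bij: "act X g \<in> Bij (pts X)" if g: "g \<in> carrier G" for g
  proof -
    have "bij_betw (act X g) (pts X) (pts X)"
      by (rule bij_betw_byWitness[where f' = "act X (inv\<^bsub>G\<^esub> g)"])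
        (use g in \<open>auto simp: inverse closed\<close>)
    then show ?thesis
      using ext'[OF g] by (simp add: Bij_def)
  qed
  \<comment> \<open>Multiplication in \<open>BijGroup\<close> is \<open>compose\<close>, so the
    homomorphism law is an equality of extensional functions and can be checked on
    \<open>pts X\<close>.\<close>
  have "act X (g \<otimes>\<^bsub>G\<^esub> h) = compose (pts X) (act X g) (act X h)"
    if "g \<in> carrier G" "h \<in> carrier G" for g h
    by (rule extensionalityI[of _ "pts X"])
      (use that in \<open>auto simp: ext' mult compose_def\<close>)
  then have "act X \<in> hom G (BijGroup (pts X))"
    using Bij by (auto simp: hom_def BijGroup_def)
  then have "group_action G (pts X) (act X)"
    by (simp add: group_action_def group_hom_def group_hom_axioms_def group_BijGroup is_group)
  then show ?thesis
    using ext by (simp add: is_gset_def)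
qed

lemma
  assumes "is_gset G X"
  shows gset_group: "group G"
    and gset_act_ext: "act X \<in> extensional (carrier G)"
    and gset_act_pts_ext: "g \<in> carrier G \<Longrightarrow> act X g \<in> extensional (pts X)"
    and gset_act_closed: "\<lbrakk>g \<in> carrier G; x \<in> pts X\<rbrakk> \<Longrightarrow> act X g x \<in> pts X"
    and gset_act_one: "x \<in> pts X \<Longrightarrow> act X \<one>\<^bsub>G\<^esub> x = x"
    and gset_act_mult: "\<lbrakk>g \<in> carrier G; h \<in> carrier G; x \<in> pts X\<rbrakk>
      \<Longrightarrow> act X (g \<otimes>\<^bsub>G\<^esub> h) x = act X g (act X h x)"
proof -
  interpret group_action G "pts X" "act X"
    using assms by (simp add: is_gset_def)
  show "group G" by (rule group_hom.axioms(1)[OF group_hom])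
  show "act X \<in> extensional (carrier G)"
    using assms by (simp add: is_gset_def)
  show "act X g \<in> extensional (pts X)" if "g \<in> carrier G"
    using bij_prop0[OF that] by (simp add: Bij_def)
  show "act X g x \<in> pts X" if "g \<in> carrier G" "x \<in> pts X"
    using element_image[OF that] by simp
  show "act X \<one>\<^bsub>G\<^esub> x = x" if "x \<in> pts X"
    using id_eq_one that by (metis restrict_apply')
  show "act X (g \<otimes>\<^bsub>G\<^esub> h) x = act X g (act X h x)"
    if "g \<in> carrier G" "h \<in> carrier G" "x \<in> pts X"
    using composition_rule that by blast
qed

text \<open>Both layers of the action are extensional, on \<open>carrier G\<close> and on the
  points, so nothing outside these sets can distinguish the records. This yields equalities of
  objects instead of mere isomorphisms.\<close>

lemma gset_eqI:
  fixes X Y :: "('g, 'x) gset"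
  assumes "is_gset G X" "is_gset G Y" "pts X = pts Y"
    and "\<And>g x. \<lbrakk>g \<in> carrier G; x \<in> pts X\<rbrakk> \<Longrightarrow> act X g x = act Y g x"
  shows "X = Y"
proof -
  have "act X g = act Y g" if "g \<in> carrier G" for g
    using gset_act_pts_ext[OF assms(1) that] gset_act_pts_ext[OF assms(2) that] assms(3,4) that
    by (intro extensionalityI[of _ "pts X"]) simp_all
  then have "act X = act Y"
    using assms by (intro extensionalityI[of _ "carrier G"]) (simp_all add: gset_act_ext)
  with assms(3) show ?thesis by simp
qed

lemma is_gset_restrict:
  assumes X: "is_gset G X" and S: "S \<subseteq> pts X"
    and stable: "\<And>g x. \<lbrakk>g \<in> carrier G; x \<in> S\<rbrakk> \<Longrightarrow> act X g x \<in> S"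
  shows "is_gset G \<lparr>pts = S, act = (\<lambda>g \<in> carrier G. restrict (act X g) S)\<rparr>"
proof -
  interpret group G using X by (rule gset_group)
  have "x \<in> pts X" if "x \<in> S" for x using that S by blast
  then show ?thesis
    by (intro is_gsetI)
      (simp_all add: stable gset_act_one[OF X] gset_act_mult[OF X] is_group)
qed

section \<open>Equivariant maps and the category of G-sets\<close>

lemma equivariant_mapsD:
  assumes "f \<in> equivariant_maps G X Y"
  shows "f \<in> extensional (pts X)"
    and "x \<in> pts X \<Longrightarrow> f x \<in> pts Y"
    and "\<lbrakk>g \<in> carrier G; x \<in> pts X\<rbrakk> \<Longrightarrow> f (act X g x) = act Y g (f x)"
  using assms by (auto simp: equivariant_maps_def PiE_def)

lemma equivariant_mapsI:
  assumes "f \<in> extensional (pts X)"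
    and "\<And>x. x \<in> pts X \<Longrightarrow> f x \<in> pts Y"
    and "\<And>g x. \<lbrakk>g \<in> carrier G; x \<in> pts X\<rbrakk> \<Longrightarrow> f (act X g x) = act Y g (f x)"
  shows "f \<in> equivariant_maps G X Y"
  using assms by (auto simp: equivariant_maps_def PiE_def)

lemma equivariant_maps_ident:
  assumes "is_gset G X"
  shows "(\<lambda>x \<in> pts X. x) \<in> equivariant_maps G X X"
  by (rule equivariant_mapsI) (simp_all add: gset_act_closed[OF assms])

lemma equivariant_maps_compose:
  assumes X: "is_gset G X"
    and f: "f \<in> equivariant_maps G X Y" and h: "h \<in> equivariant_maps G Y Z"
  shows "compose (pts X) h f \<in> equivariant_maps G X Z"
  by (rule equivariant_mapsI)
    (simp_all add: compose_eq gset_act_closed[OF X] equivariant_mapsD[OF f] equivariant_mapsD[OF h])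

lemma GSet_simps [simp]:
  "Ob (GSet G) = {X. is_gset G X}"
  "Hom (GSet G) = equivariant_maps G"
  "Ident (GSet G) X = (\<lambda>x \<in> pts X. x)"
  "Comp (GSet G) X Y Z g f = compose (pts X) g f"
  by (simp_all add: GSet_def)

lemma category_GSet:
  fixes G :: "('g, 'b) monoid_scheme"
  shows "category (GSet G :: (('g, 'x) gset, 'x \<Rightarrow> 'x) cat)"
proof
  fix X Y :: "('g, 'x) gset" and f
  assume "f \<in> Hom (GSet G) X Y"
  then have f: "f \<in> equivariant_maps G X Y" by simp
  show "Comp (GSet G) X Y Y (Ident (GSet G) Y) f = f"
    by (rule extensionalityI[of _ "pts X"])
      (simp_all add: compose_eq equivariant_mapsD[OF f])
  show "Comp (GSet G) X X Y f (Ident (GSet G) X) = f"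
    by (rule extensionalityI[of _ "pts X"])
      (simp_all add: compose_eq equivariant_mapsD[OF f])
next
  fix W X Y Z :: "('g, 'x) gset" and f g h
  assume "f \<in> Hom (GSet G) W X"
  then have f: "f \<in> equivariant_maps G W X" by simp
  show "Comp (GSet G) W X Z (Comp (GSet G) X Y Z h g) f
      = Comp (GSet G) W Y Z h (Comp (GSet G) W X Y g f)"
    by (rule extensionalityI[of _ "pts W"])
      (simp_all add: compose_eq equivariant_mapsD[OF f])
qed (auto intro: equivariant_maps_ident equivariant_maps_compose)

lemma is_gset_coset_gset:
  assumes "group G" "subgroup H G"
  shows "is_gset G (coset_gset G H)"
proof -
  interpret group G by fact
  \<comment> \<open>The library laws for the unit and for associativity of left translation are
    stated for subsets of the carrier.\<close>
  have sub: "K \<subseteq> carrier G" if "K \<in> lcosets\<^bsub>G\<^esub> H" for K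
    using that l_coset_subset_G[OF subgroup.subset[OF assms(2)]] by (auto simp: LCOSETS_def)
  show ?thesis
    by (rule is_gsetI)
      (simp_all add: coset_gset_def is_group lcosets_closed[OF assms] lcos_mult_one lcos_m_assoc sub)
qed

section \<open>The trace of a G-set\<close>

lemma trace_ptsI:
  assumes "\<alpha> \<in> equivariant_maps G (coset_gset G H) X" "K \<in> pts (coset_gset G H)"
  shows "\<alpha> K \<in> trace_pts G H X"
  using assms unfolding trace_pts_def by blast

lemma trace_ptsE:
  assumes "x \<in> trace_pts G H X"
  obtains \<alpha> K where "\<alpha> \<in> equivariant_maps G (coset_gset G H) X" "K \<in> pts (coset_gset G H)"
    "x = \<alpha> K"
  using assms unfolding trace_pts_def by blast

lemma trace_pts_subset: "trace_pts G H X \<subseteq> pts X"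
  by (auto elim!: trace_ptsE intro: equivariant_mapsD(2))

lemma trace_gset_simps [simp]:
  "pts (trace_gset G H X) = trace_pts G H X"
  "\<lbrakk>g \<in> carrier G; x \<in> trace_pts G H X\<rbrakk> \<Longrightarrow> act (trace_gset G H X) g x = act X g x"
  by (simp_all add: trace_gset_def)

lemma trace_functor_simps [simp]:
  "obj_map (trace_functor G H) X = trace_gset G H X"
  "arr_map (trace_functor G H) X Y f = restrict f (trace_pts G H X)"
  by (simp_all add: trace_functor_def)

context
  fixes G :: "('g, 'b) monoid_scheme" and H :: "'g set"
  assumes G: "group G" and H: "subgroup H G"
begin

text \<open>If x = \<alpha> K, then acting by g gives \<alpha> (gK), and gK is again a left coset,
  so each image of G/H is stable.\<close>

lemma act_in_trace_pts:
  assumes "g \<in> carrier G" "x \<in> trace_pts G H X"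
  shows "act X g x \<in> trace_pts G H X"
proof -
  obtain \<alpha> K where \<alpha>: "\<alpha> \<in> equivariant_maps G (coset_gset G H) X"
    and K: "K \<in> pts (coset_gset G H)" and x: "x = \<alpha> K"
    using assms(2) by (rule trace_ptsE)
  have "act X g x = \<alpha> (act (coset_gset G H) g K)"
    unfolding x using equivariant_mapsD(3)[OF \<alpha> assms(1) K] by simp
  then show ?thesis
    using trace_ptsI[OF \<alpha>] gset_act_closed[OF is_gset_coset_gset[OF G H] assms(1) K] by metis
qed

lemma is_gset_trace_gset:
  assumes "is_gset G X"
  shows "is_gset G (trace_gset G H X)"
  unfolding trace_gset_def
  by (rule is_gset_restrict[OF assms trace_pts_subset act_in_trace_pts])

text \<open>Following a map G/H -> X by \<open>f\<close> gives a map G/H -> Y that hits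
  \<open>f x\<close>. This makes restriction to traces possible and drives both functoriality and
  naturality.\<close>

lemma equivariant_map_trace_pts:
  assumes f: "f \<in> equivariant_maps G X Y" and "x \<in> trace_pts G H X"
  shows "f x \<in> trace_pts G H Y"
proof -
  obtain \<alpha> K where \<alpha>: "\<alpha> \<in> equivariant_maps G (coset_gset G H) X"
    and K: "K \<in> pts (coset_gset G H)" and x: "x = \<alpha> K"
    using assms(2) by (rule trace_ptsE)
  have "compose (pts (coset_gset G H)) f \<alpha> K \<in> trace_pts G H Y"
    by (intro trace_ptsI equivariant_maps_compose[OF is_gset_coset_gset[OF G H] \<alpha> f] K)
  then show ?thesis
    using K by (simp add: compose_eq x)
qed

lemma equivariant_maps_trace:
  assumes f: "f \<in> equivariant_maps G X Y"
  shows "restrict f (trace_pts G H X) \<in> equivariant_maps G (trace_gset G H X) (trace_gset G H Y)"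
  by (rule equivariant_mapsI)
    (simp_all add: equivariant_map_trace_pts[OF f] act_in_trace_pts
      equivariant_mapsD(3)[OF f] subsetD[OF trace_pts_subset])

lemma trace_inclusion_equivariant:
  "trace_inclusion G H X \<in> equivariant_maps G (trace_gset G H X) X"
  by (rule equivariant_mapsI)
    (simp_all add: trace_inclusion_def act_in_trace_pts subsetD[OF trace_pts_subset])

text \<open>The natural index set consists of maps on cosets, not of points of \<open>X\<close>,
  whereas \<open>H_generated\<close> asks for indices of the type of points.
  \<open>H_generatedI\<close> accepts any index type and bridges the gap.\<close>

lemma H_generated_trace_gset: "H_generated G H (trace_gset G H X)"
proof (rule H_generatedI[OF G H])
  let ?L = "pts (coset_gset G H)"
  let ?I = "equivariant_maps G (coset_gset G H) X"
  \<comment> \<open>Evaluation of each map at each coset; its image is the union that defines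
    \<open>trace_pts\<close>.\<close>
  let ?p = "\<lambda>(\<alpha>, K) \<in> ?I \<times> ?L. \<alpha> K"
  show "?p \<in> equivariant_maps G (coprod_gset G ?I (\<lambda>_. coset_gset G H)) (trace_gset G H X)"
    by (rule equivariant_mapsI)
      (auto simp: coprod_gset_def trace_ptsI gset_act_closed[OF is_gset_coset_gset[OF G H]]
        equivariant_mapsD(3))
  show "?p ` pts (coprod_gset G ?I (\<lambda>_. coset_gset G H)) = pts (trace_gset G H X)"
    by (force simp: coprod_gset_def trace_pts_def)
qed

lemma trace_gset_in_GSet_H_objs:
  "is_gset G X \<Longrightarrow> trace_gset G H X \<in> GSet_H_objs G H"
  by (simp add: GSet_H_objs_def is_gset_trace_gset H_generated_trace_gset)

section \<open>H-generated G-sets as the fixed objects of the trace\<close>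

lemma trace_pts_H_generated:
  fixes X :: "('g, 'x) gset"
  assumes "H_generated G H X"
  shows "trace_pts G H X = pts X"
proof
  let ?L = "coset_gset G H"
  obtain I :: "'x set" and p where p: "p \<in> equivariant_maps G (coprod_gset G I (\<lambda>_. ?L)) X"
    and surj: "p ` pts (coprod_gset G I (\<lambda>_. ?L)) = pts X"
    using assms unfolding H_generated_def by blast
  show "pts X \<subseteq> trace_pts G H X"
  proof
    fix x assume "x \<in> pts X"
    then have "x \<in> p ` (I \<times> pts ?L)"
      using surj by (simp add: coprod_gset_def)
    then obtain i K where i: "i \<in> I" and K: "K \<in> pts ?L" and x: "x = p (i, K)"
      by blast
    \<comment> \<open>The summand with index \<open>i\<close>: the group acts only on the second
      component, so M |-> (i, M) is equivariant.\<close>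
    have coprod: "(i, M) \<in> pts (coprod_gset G I (\<lambda>_. ?L))"
      "g \<in> carrier G \<Longrightarrow> act (coprod_gset G I (\<lambda>_. ?L)) g (i, M) = (i, act ?L g M)"
      if "M \<in> pts ?L" for g M
      using i that by (simp_all add: coprod_gset_def)
    have "p (i, act ?L g M) = act X g (p (i, M))" if "g \<in> carrier G" "M \<in> pts ?L" for g M
      using equivariant_mapsD(3)[OF p that(1) coprod(1)[OF that(2)]]
      by (simp add: coprod(2)[OF that(2,1)])
    \<comment> \<open>The composite of the summand inclusion with \<open>p\<close>; its value at
      \<open>K\<close> is the given point \<open>x\<close>.\<close>
    then have "(\<lambda>M \<in> pts ?L. p (i, M)) \<in> equivariant_maps G ?L X"
      using gset_act_closed[OF is_gset_coset_gset[OF G H]]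
      by (intro equivariant_mapsI) (simp_all add: equivariant_mapsD(2)[OF p] coprod)
    from trace_ptsI[OF this K] show "x \<in> trace_pts G H X"
      using K by (simp add: x)
  qed
qed (rule trace_pts_subset)

text \<open>Equality on the nose is what allows identity maps to serve as the components of the
  unit.\<close>

lemma trace_gset_H_generated:
  assumes "X \<in> GSet_H_objs G H"
  shows "trace_gset G H X = X"
proof -
  have X: "is_gset G X" "trace_pts G H X = pts X"
    using assms by (simp_all add: GSet_H_objs_def trace_pts_H_generated)
  show ?thesis
    by (rule gset_eqI[OF is_gset_trace_gset[OF X(1)] X(1)]) (simp_all add: X(2))
qed

section \<open>The trace functor and the coreflection adjunction\<close>

lemma is_functor_trace_functor:
  "is_functor (GSet G) (full_subcat (GSet G) (GSet_H_objs G H)) (trace_functor G H)"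
proof -
  have "GSet_H_objs G H \<subseteq> Ob (GSet G)"
    by (auto simp: GSet_H_objs_def)
  then interpret sub: category "full_subcat (GSet G) (GSet_H_objs G H)"
    by (rule category_full_subcat[OF category_GSet])
  interpret category "GSet G" by (rule category_GSet)
  show ?thesis
  proof
    fix X Y Z :: "('g, 'x) gset" and f g
    assume "f \<in> Hom (GSet G) X Y"
    then have f: "f \<in> equivariant_maps G X Y" by simp
    \<comment> \<open>On the right, the restriction of \<open>g\<close> is evaluated at
      \<open>f x\<close>. This lies in the trace of \<open>Y\<close>, so the restriction returns
      \<open>g (f x)\<close> there and not the default value \<open>undefined\<close>.\<close>
    show "arr_map (trace_functor G H) X Z (Comp (GSet G) X Y Z g f)
      = Comp (full_subcat (GSet G) (GSet_H_objs G H)) (obj_map (trace_functor G H) X)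
          (obj_map (trace_functor G H) Y) (obj_map (trace_functor G H) Z)
          (arr_map (trace_functor G H) Y Z g) (arr_map (trace_functor G H) X Y f)"
      by (rule extensionalityI[of _ "trace_pts G H X"])
        (simp_all add: compose_eq equivariant_map_trace_pts[OF f] subsetD[OF trace_pts_subset])
  next
    fix X :: "('g, 'x) gset"
    show "arr_map (trace_functor G H) X X (Ident (GSet G) X)
      = Ident (full_subcat (GSet G) (GSet_H_objs G H)) (obj_map (trace_functor G H) X)"
      by (rule extensionalityI[of _ "trace_pts G H X"])
        (simp_all add: Int_absorb1[OF trace_pts_subset] subsetD[OF trace_pts_subset])
  qed (simp_all add: trace_gset_in_GSet_H_objs equivariant_maps_trace)
qed

lemma is_coreflector_trace:
  "is_coreflector (GSet G) (GSet_H_objs G H) (trace_functor G H) (trace_inclusion G H)"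
proof -
  let ?C = "full_subcat (GSet G) (GSet_H_objs G H)"
  have sub: "GSet_H_objs G H \<subseteq> Ob (GSet G)"
    by (auto simp: GSet_H_objs_def)
  have gset: "is_gset G X" if "X \<in> GSet_H_objs G H" for X
    using that by (simp add: GSet_H_objs_def)
  have pts: "trace_pts G H X = pts X" if "X \<in> GSet_H_objs G H" for X
    using that by (simp add: GSet_H_objs_def trace_pts_H_generated)
  \<comment> \<open>These interpretations discharge all functor obligations of
    \<open>adjunction\<close>, leaving the components and naturality of unit and counit and the two
    triangle identities.\<close>
  interpret I: is_functor ?C "GSet G" incl_functor
    by (rule is_functor_incl[OF category_GSet sub])
  interpret T: is_functor "GSet G" ?C "trace_functor G H"
    by (rule is_functor_trace_functor)
  interpret IC: is_functor ?C ?C incl_functor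
    by (rule is_functor_incl_self[OF I.source.category_axioms])
  interpret IG: is_functor "GSet G" "GSet G" incl_functor
    by (rule is_functor_incl_self[OF category_GSet])
  interpret TI: is_functor ?C ?C "comp_functor (trace_functor G H) incl_functor"
    by (rule is_functor_comp[OF I.is_functor_axioms T.is_functor_axioms])
  interpret IT: is_functor "GSet G" "GSet G" "comp_functor incl_functor (trace_functor G H)"
    by (rule is_functor_comp[OF T.is_functor_axioms I.is_functor_axioms])
  have "adjunction ?C (GSet G) incl_functor (trace_functor G H) (Ident (GSet G))
    (trace_inclusion G H)"
  proof
    fix X assume "X \<in> Ob ?C"
    then show "Ident (GSet G) X \<in> Hom ?C (obj_map incl_functor X)
        (obj_map (comp_functor (trace_functor G H) incl_functor) X)"
      by (simp add: trace_gset_H_generated equivariant_maps_ident gset del: restrict_apply)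
  next
    fix X Y f assume X: "X \<in> Ob ?C" and "Y \<in> Ob ?C" and "f \<in> Hom ?C X Y"
    then have f: "f \<in> equivariant_maps G X Y" by simp
    \<comment> \<open>Since \<open>trace_pts G H X\<close> is all of \<open>pts X\<close>, the
      restricted arrow is \<open>f\<close> itself, and both composites with identities reduce to
      \<open>f\<close>.\<close>
    show "Comp ?C (obj_map incl_functor X) (obj_map incl_functor Y)
        (obj_map (comp_functor (trace_functor G H) incl_functor) Y)
        (Ident (GSet G) Y) (arr_map incl_functor X Y f)
      = Comp ?C (obj_map incl_functor X)
        (obj_map (comp_functor (trace_functor G H) incl_functor) X)
        (obj_map (comp_functor (trace_functor G H) incl_functor) Y)
        (arr_map (comp_functor (trace_functor G H) incl_functor) X Y f) (Ident (GSet G) X)"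
      by (rule extensionalityI[of _ "pts X"])
        (use X in \<open>simp_all add: compose_eq equivariant_mapsD[OF f] pts\<close>)
  next
    fix Y assume "Y \<in> Ob (GSet G)"
    show "trace_inclusion G H Y \<in> Hom (GSet G)
        (obj_map (comp_functor incl_functor (trace_functor G H)) Y) (obj_map incl_functor Y)"
      by (simp add: trace_inclusion_equivariant)
  next
    fix X Y f assume "f \<in> Hom (GSet G) X Y"
    then have f: "f \<in> equivariant_maps G X Y" by simp
    \<comment> \<open>Both sides send a point x of the trace of \<open>X\<close> to f x; on the left
      the inclusion is applied to f x, which lies in the trace of \<open>Y\<close>.\<close>
    show "Comp (GSet G) (obj_map (comp_functor incl_functor (trace_functor G H)) X)
        (obj_map (comp_functor incl_functor (trace_functor G H)) Y) (obj_map incl_functor Y)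
        (trace_inclusion G H Y)
        (arr_map (comp_functor incl_functor (trace_functor G H)) X Y f)
      = Comp (GSet G) (obj_map (comp_functor incl_functor (trace_functor G H)) X)
        (obj_map incl_functor X) (obj_map incl_functor Y)
        (arr_map incl_functor X Y f) (trace_inclusion G H X)"
      by (rule extensionalityI[of _ "trace_pts G H X"])
        (simp_all add: compose_eq trace_inclusion_def equivariant_map_trace_pts[OF f])
  next
    fix X assume "X \<in> Ob ?C"
    then show "Comp (GSet G) (obj_map incl_functor X)
        (obj_map incl_functor (obj_map (trace_functor G H) (obj_map incl_functor X)))
        (obj_map incl_functor X) (trace_inclusion G H (obj_map incl_functor X))
        (arr_map incl_functor X (obj_map (trace_functor G H) (obj_map incl_functor X))
          (Ident (GSet G) X))
      = Ident (GSet G) (obj_map incl_functor X)"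
      by (intro extensionalityI[of _ "pts X"])
        (simp_all add: compose_eq trace_inclusion_def pts)
  next
    fix Y assume "Y \<in> Ob (GSet G)"
    \<comment> \<open>The trace of \<open>Y\<close> is H-generated, so a second trace loses no
      points. The restricted counit is therefore the identity on \<open>trace_pts G H Y\<close>,
      which gives the second triangle.\<close>
    then have "trace_pts G H (trace_gset G H Y) = trace_pts G H Y"
      using pts[OF trace_gset_in_GSet_H_objs] by simp
    then show "Comp ?C (obj_map (trace_functor G H) Y)
        (obj_map (trace_functor G H) (obj_map incl_functor (obj_map (trace_functor G H) Y)))
        (obj_map (trace_functor G H) Y)
        (arr_map (trace_functor G H) (obj_map incl_functor (obj_map (trace_functor G H) Y)) Y
          (trace_inclusion G H Y))
        (Ident (GSet G) (obj_map (trace_functor G H) Y))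
      = Ident ?C (obj_map (trace_functor G H) Y)"
      by (intro extensionalityI[of _ "trace_pts G H Y"])
        (simp_all add: compose_eq trace_inclusion_def)
  qed
  with sub show ?thesis
    unfolding is_coreflector_def by blast
qed

end

theorem proposition18:
  fixes G :: "('g, 'b) monoid_scheme" and H :: "'g set"
  assumes "group G" and "subgroup H G"
  shows "coreflective (GSet G :: (('g, 'x) gset, 'x \<Rightarrow> 'x) cat) (GSet_H_objs G H)
    \<and> is_coreflector (GSet G :: (('g, 'x) gset, 'x \<Rightarrow> 'x) cat) (GSet_H_objs G H)
        (trace_functor G H) (trace_inclusion G H)"
  using is_coreflector_trace[OF assms] unfolding coreflective_def by blast

end
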